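(* Let $T>0$, $b\in\mathbb{R}$, and let $K(t,s,u)$ be a real-valued kernel ($0\le s\le t\le T$, $u\in\mathbb{R}$) which is continuous in $(t,s)$, locally Lipschitz in $u$, and possesses a partial derivative $\frac{\partial K}{\partial u}(t,s,u)$ that is continuous in all variables. Consider the nonlinear Volterra integral equation $$u(t)=b+\int_0^t K(t,s,u(s))\,ds,\qquad t\in[0,T],$$ and the operator $F$ on $C[0,T]$ given by $F(u)(t)=u(t)-b-\int_0^t K(t,s,u(s))\,ds$. Let $u^\ast\in C[0,T]$ be the exact solution, i.e. $F(u^\ast)=0$. Assume that the Fréchet derivative $F'(u)$ is invertible for $u$ in a neighborhood of $u^\ast$, and that $F'$ is Lipschitz continuous with constant $L$ in this neighborhood: $$\|F'(u_1)-F'(u_2)\|\le L\,\|u_1-u_2\|_\infty .$$ Let $u_0\in C[0,T]$ be an initial approximation and consider the Newton--Kantorovich iteration $$u_{n+1}=u_n-[F'(u_n)]^{-1}F(u_n),\qquad n\ge 0.$$ Let $M=\sup_n\|[F'(u_n)]^{-1}\|$, and suppose that the initial error $e_0=u_0-u^\ast$ satisfies $$L\,M\,\|e_0\|_\infty<1.$$ Then the iteration is well defined, and the sequence $\{u_n\}$ converges quadratically to the unique solution $u^\ast$ of the Volterra equation: $u_n\to u^\ast$ in $\|\cdot\|_\infty$ and, for all $n\ge 0$, $$\|u_{n+1}-u^\ast\|_\infty\le C\,\|u_n-u^\ast\|_\infty^2,\qquad C=\tfrac12 LM .$$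
   Context: $C[0,T]$ is the Banach space of continuous real-valued functions on $[0,T]$ with norm $\|u\|_\infty=\max_{t\in[0,T]}|u(t)|$. The norm of a bounded linear operator on $C[0,T]$ is the operator norm induced by $\|\cdot\|_\infty$. The Fréchet derivative of $F$ at $u\in C[0,T]$ is the bounded linear operator on $C[0,T]$ given by $(F'(u)v)(t)=v(t)-\int_0^t \frac{\partial K}{\partial u}(t,s,u(s))\,v(s)\,ds$.
   Formalization: The neighborhood of u* is additionally assumed to contain the closed ball about u* of radius ‖e_0‖ in C[0,T] (for a ball: u_0 lies in it); for arbitrary u_0 the claim fails, e.g. when L=0 near u*. M is assumed finite. *)

theory Defs
  imports "HOL-Analysis.Analysis"
begin

text \<open>
  The interval length T is a variable, so the space C[0,T] cannot be a type of its own.  It is the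
  subspace of the bounded continuous functions on the real line consisting of those that are
  constant to the left of 0 and to the right of T.  Every continuous function on [0,T] has exactly
  one such extension (lemmas \<open>apply_to_C\<close> and \<open>C_eqI\<close>), and the supremum norm of the extension is
  the supremum norm on [0,T] (lemma \<open>norm_C\<close>), so the norm, the metric and the linear structure of
  C[0,T] are those of the ambient type.
\<close>

definition C_space :: "real \<Rightarrow> (real \<Rightarrow>\<^sub>C real) set" where
  "C_space T = {u. \<forall>t. apply_bcontfun u t = apply_bcontfun u (clamp 0 T t)}"

text \<open>The element of C[0,T] given by f on [0,T]; meaningful for f continuous on [0,T].\<close>

definition to_C :: "real \<Rightarrow> (real \<Rightarrow> real) \<Rightarrow> real \<Rightarrow>\<^sub>C real" where
  "to_C T f = Bcontfun (ext_cont f 0 T)"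

lemma apply_to_C:
  assumes "0 \<le> T" "continuous_on {0..T} f"
  shows "to_C T f \<in> C_space T"
    and "\<And>t. t \<in> {0..T} \<Longrightarrow> apply_bcontfun (to_C T f) t = f t"
proof -
  have c: "continuous_on (cbox 0 T) f" using assms by (simp add: cbox_interval)
  have "ext_cont f 0 T \<in> bcontfun"
    unfolding bcontfun_def
    using continuous_on_ext_cont[OF c]
      clamp_bounded[OF compact_imp_bounded[OF compact_continuous_image[OF c compact_cbox]]]
    by (auto simp: ext_cont_def)
  then have a: "apply_bcontfun (to_C T f) = ext_cont f 0 T"
    by (simp add: to_C_def Bcontfun_inverse)
  have "clamp 0 T t \<in> cbox 0 T" for t :: real
    using assms(1) by (intro clamp_in_interval) (simp add: Basis_real_def)
  then show "to_C T f \<in> C_space T"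
    by (simp add: C_space_def a ext_cont_def clamp_cancel_cbox)
  show "apply_bcontfun (to_C T f) t = f t" if "t \<in> {0..T}" for t
    using that by (simp add: a ext_cont_def cbox_interval clamp_cancel_cbox)
qed

lemma C_eqI:
  assumes "0 \<le> T" "u \<in> C_space T" "v \<in> C_space T"
    and "\<And>t. t \<in> {0..T} \<Longrightarrow> apply_bcontfun u t = apply_bcontfun v t"
  shows "u = v"
proof (rule bcontfun_eqI)
  fix t :: real
  have "clamp 0 T t \<in> {0..T}"
    using clamp_in_interval[of 0 T t] assms(1) by (simp add: Basis_real_def cbox_interval)
  then show "apply_bcontfun u t = apply_bcontfun v t"
    using assms unfolding C_space_def by (metis (mono_tags, lifting) mem_Collect_eq)
qed

lemma norm_C:
  assumes "0 \<le> T" "u \<in> C_space T"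
  shows "norm u = (SUP t\<in>{0..T}. \<bar>apply_bcontfun u t\<bar>)"
proof -
  have cl: "clamp 0 T t \<in> {0..T}" for t :: real
    using clamp_in_interval[of 0 T t] assms(1) by (simp add: Basis_real_def cbox_interval)
  have "range (\<lambda>t. \<bar>apply_bcontfun u t\<bar>) = (\<lambda>t. \<bar>apply_bcontfun u t\<bar>) ` {0..T}"
  proof
    show "range (\<lambda>t. \<bar>apply_bcontfun u t\<bar>) \<subseteq> (\<lambda>t. \<bar>apply_bcontfun u t\<bar>) ` {0..T}"
    proof clarify
      fix t :: real
      have "apply_bcontfun u t = apply_bcontfun u (clamp 0 T t)"
        using assms(2) unfolding C_space_def by blast
      then show "\<bar>apply_bcontfun u t\<bar> \<in> (\<lambda>t. \<bar>apply_bcontfun u t\<bar>) ` {0..T}"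
        using cl[of t] by (intro image_eqI) auto
    qed
  qed auto
  moreover have "norm u = (SUP t. \<bar>apply_bcontfun u t\<bar>)"
    by (simp add: norm_bcontfun_def dist_bcontfun_def const_bcontfun.rep_eq zero_bcontfun.rep_eq
        dist_norm)
  ultimately show ?thesis by simp
qed

text \<open>
  Operators on C[0,T] are functions on the ambient type, only ever evaluated on \<open>C_space T\<close>.
\<close>

definition bounded_linear_C ::
    "real \<Rightarrow> ((real \<Rightarrow>\<^sub>C real) \<Rightarrow> (real \<Rightarrow>\<^sub>C real)) \<Rightarrow> bool" where
  "bounded_linear_C T A \<longleftrightarrow>
     (\<forall>v\<in>C_space T. A v \<in> C_space T) \<and>
     (\<forall>v\<in>C_space T. \<forall>w\<in>C_space T. A (v + w) = A v + A w) \<and>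
     (\<forall>c. \<forall>v\<in>C_space T. A (c *\<^sub>R v) = c *\<^sub>R A v) \<and>
     (\<exists>B. \<forall>v\<in>C_space T. norm (A v) \<le> B * norm v)"

definition opnorm_C :: "real \<Rightarrow> ((real \<Rightarrow>\<^sub>C real) \<Rightarrow> (real \<Rightarrow>\<^sub>C real)) \<Rightarrow> real" where
  "opnorm_C T A = (SUP v\<in>C_space T. norm (A v) / norm v)"

definition inverse_C ::
    "real \<Rightarrow> ((real \<Rightarrow>\<^sub>C real) \<Rightarrow> (real \<Rightarrow>\<^sub>C real)) \<Rightarrow> (real \<Rightarrow>\<^sub>C real) \<Rightarrow> (real \<Rightarrow>\<^sub>C real)" where
  "inverse_C T A = inv_into (C_space T) A"

definition invertible_C ::
    "real \<Rightarrow> ((real \<Rightarrow>\<^sub>C real) \<Rightarrow> (real \<Rightarrow>\<^sub>C real)) \<Rightarrow> bool" where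
  "invertible_C T A \<longleftrightarrow>
     bounded_linear_C T A \<and> bij_betw A (C_space T) (C_space T) \<and> bounded_linear_C T (inverse_C T A)"

definition kernel_domain :: "real \<Rightarrow> (real \<times> real) set" where
  "kernel_domain T = {(t, s). 0 \<le> s \<and> s \<le> t \<and> t \<le> T}"

definition volterra_solution ::
    "real \<Rightarrow> (real \<Rightarrow> real \<Rightarrow> real \<Rightarrow> real) \<Rightarrow> real \<Rightarrow> (real \<Rightarrow>\<^sub>C real) \<Rightarrow> bool" where
  "volterra_solution T K b u \<longleftrightarrow>
     (\<forall>t\<in>{0..T}. apply_bcontfun u t = b + integral {0..t} (\<lambda>s. K t s (apply_bcontfun u s)))"

definition volterra_F ::
    "real \<Rightarrow> (real \<Rightarrow> real \<Rightarrow> real \<Rightarrow> real) \<Rightarrow> real \<Rightarrow> (real \<Rightarrow>\<^sub>C real) \<Rightarrow> (real \<Rightarrow>\<^sub>C real)" where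
  "volterra_F T K b u =
     to_C T (\<lambda>t. apply_bcontfun u t - b - integral {0..t} (\<lambda>s. K t s (apply_bcontfun u s)))"

text \<open>The Frechet derivative of \<open>volterra_F\<close> at u; \<open>Ku\<close> is the partial derivative of K in u.\<close>

definition volterra_F' ::
    "real \<Rightarrow> (real \<Rightarrow> real \<Rightarrow> real \<Rightarrow> real) \<Rightarrow> (real \<Rightarrow>\<^sub>C real) \<Rightarrow> (real \<Rightarrow>\<^sub>C real) \<Rightarrow> (real \<Rightarrow>\<^sub>C real)" where
  "volterra_F' T Ku u v =
     to_C T (\<lambda>t. apply_bcontfun v t
       - integral {0..t} (\<lambda>s. Ku t s (apply_bcontfun u s) * apply_bcontfun v s))"

text \<open>
  \<open>inverse_C\<close> is total, so this sequence always exists formally; the iteration is well defined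
  when every iterate lies in \<open>C_space T\<close> and the derivative there satisfies \<open>invertible_C\<close>.
\<close>

primrec newton ::
    "real \<Rightarrow> (real \<Rightarrow> real \<Rightarrow> real \<Rightarrow> real) \<Rightarrow> (real \<Rightarrow> real \<Rightarrow> real \<Rightarrow> real) \<Rightarrow> real \<Rightarrow>
      (real \<Rightarrow>\<^sub>C real) \<Rightarrow> nat \<Rightarrow> (real \<Rightarrow>\<^sub>C real)" where
  "newton T K Ku b u0 0 = u0"
| "newton T K Ku b u0 (Suc n) =
     newton T K Ku b u0 n
       - inverse_C T (volterra_F' T Ku (newton T K Ku b u0 n))
           (volterra_F T K b (newton T K Ku b u0 n))"

end

theory Submission
  imports Defs
begin

text \<open>
  Write e for the error of the current Newton iterate w and A for the derivative of F at w.  Since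
  A has an inverse and F vanishes at the solution, the next error is the inverse of A applied
  to the first-order Taylor remainder of F between w and the solution
  (\<open>newton_step_error\<close>).  The Lipschitz condition on the derivative bounds this remainder by
  L/2 times the square of the norm of e (\<open>volterra_F_taylor_remainder\<close>), which gives the
  constant L M / 2.

  The remainder estimate is obtained pointwise in time: for fixed t, the value at t of F along a
  segment is a real function of one real parameter, differentiable under the integral sign, so
  a comparison of scalar derivatives suffices.

  By the smallness of L M times the initial error, each step at least halves the error.
  Hence the iterates never leave the ball around the solution on which the derivative is
  invertible and Lipschitz, and they converge.

  Uniqueness of the solution holds globally and is independent of the iteration: the
  difference of two solutions satisfies a homogeneous Gronwall inequality
  (\<open>gronwall_zero\<close>), because K is uniformly Lipschitz on bounded sets of values.
\<close>

section \<open>The space C[0,T] and its operators\<close>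

lemma C_space_linear:
  shows C_space_zero: "0 \<in> C_space T"
    and C_space_add: "u \<in> C_space T \<Longrightarrow> v \<in> C_space T \<Longrightarrow> u + v \<in> C_space T"
    and C_space_diff: "u \<in> C_space T \<Longrightarrow> v \<in> C_space T \<Longrightarrow> u - v \<in> C_space T"
    and C_space_scaleR: "u \<in> C_space T \<Longrightarrow> c *\<^sub>R u \<in> C_space T"
    and C_space_const: "const_bcontfun x \<in> C_space T"
proof -
  show "u + v \<in> C_space T" if "u \<in> C_space T" "v \<in> C_space T"
    using that unfolding C_space_def plus_bcontfun.rep_eq mem_Collect_eq by metis
  show "u - v \<in> C_space T" if "u \<in> C_space T" "v \<in> C_space T"
    using that unfolding C_space_def minus_bcontfun.rep_eq mem_Collect_eq by metis
  show "c *\<^sub>R u \<in> C_space T" if "u \<in> C_space T"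
    using that unfolding C_space_def scaleR_bcontfun.rep_eq mem_Collect_eq by metis
qed (simp_all add: C_space_def zero_bcontfun.rep_eq const_bcontfun.rep_eq)

lemma norm_C_le:
  assumes "0 \<le> T" "z \<in> C_space T" "\<And>t. t \<in> {0..T} \<Longrightarrow> \<bar>apply_bcontfun z t\<bar> \<le> B"
  shows "norm z \<le> B"
  unfolding norm_C[OF assms(1,2)] using assms(1,3) by (intro cSUP_least) auto

lemma continuous_apply_bcontfun: "continuous_on S (apply_bcontfun u)"
  using apply_bcontfun[of u] continuous_on_subset unfolding bcontfun_def by blast

lemma bounded_linear_C_diff:
  assumes A: "bounded_linear_C T A" and v: "v \<in> C_space T" and w: "w \<in> C_space T"
  shows "A (v - w) = A v - A w"
proof -
  have "A (v + (- 1) *\<^sub>R w) = A v + (- 1) *\<^sub>R A w"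
    using A v w C_space_scaleR[OF w, of "-1"] unfolding bounded_linear_C_def by metis
  then show ?thesis by simp
qed

lemma bounded_linear_C_minus_fun:
  assumes A: "bounded_linear_C T A" and B: "bounded_linear_C T B"
  shows "bounded_linear_C T (\<lambda>v. A v - B v)"
proof -
  obtain a where a: "\<And>v. v \<in> C_space T \<Longrightarrow> norm (A v) \<le> a * norm v"
    using A unfolding bounded_linear_C_def by blast
  obtain b where b: "\<And>v. v \<in> C_space T \<Longrightarrow> norm (B v) \<le> b * norm v"
    using B unfolding bounded_linear_C_def by blast
  have "norm (A v - B v) \<le> (a + b) * norm v" if "v \<in> C_space T" for v
    using norm_triangle_ineq4[of "A v" "B v"] a[OF that] b[OF that]
    by (simp add: algebra_simps)
  then show ?thesis
    using A B unfolding bounded_linear_C_def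
    by (simp add: C_space_diff scaleR_diff_right) blast
qed

text \<open>
  The supremum defining the operator norm is taken over a set bounded above precisely because the
  operator is bounded; the quotient at v = 0 is 0, which also makes the norm nonnegative.
\<close>

lemma opnorm_C_props:
  assumes A: "bounded_linear_C T A"
  shows opnorm_C_bound: "v \<in> C_space T \<Longrightarrow> norm (A v) \<le> opnorm_C T A * norm v"
    and opnorm_C_nonneg: "0 \<le> opnorm_C T A"
proof -
  obtain a where a: "\<And>v. v \<in> C_space T \<Longrightarrow> norm (A v) \<le> a * norm v"
    using A unfolding bounded_linear_C_def by blast
  have "norm (A v) / norm v \<le> max a 0" if "v \<in> C_space T" for v
  proof (cases "v = 0")
    case False
    then have "norm (A v) / norm v \<le> a" using a[OF that] by (simp add: field_simps)
    then show ?thesis by simp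
  qed simp
  then have bdd: "bdd_above ((\<lambda>v. norm (A v) / norm v) ` C_space T)"
    by (intro bdd_aboveI[where M = "max a 0"]) auto
  have upper: "norm (A v) / norm v \<le> opnorm_C T A" if "v \<in> C_space T" for v
    unfolding opnorm_C_def using that bdd by (intro cSUP_upper) auto
  show "norm (A v) \<le> opnorm_C T A * norm v" if v: "v \<in> C_space T"
  proof (cases "v = 0")
    case True
    then show ?thesis using a[OF v] by simp
  next
    case False
    then show ?thesis using upper[OF v] by (simp add: field_simps)
  qed
  show "0 \<le> opnorm_C T A"
    using upper[OF C_space_zero] by simp
qed

lemma
  assumes "invertible_C T A" and "v \<in> C_space T"
  shows inverse_C_left: "inverse_C T A (A v) = v"
    and inverse_C_closed: "inverse_C T A v \<in> C_space T"
  using assms unfolding invertible_C_def inverse_C_def bounded_linear_C_def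
  by (auto simp: bij_betw_def)

section \<open>Volterra integrals with a continuous integrand\<close>

lemma kernel_domain_slice: "t \<in> {0..T} \<Longrightarrow> s \<in> {0..t} \<Longrightarrow> (t, s) \<in> kernel_domain T"
  by (auto simp: kernel_domain_def)

lemma compact_kernel_domain: "compact (kernel_domain T)"
proof -
  have "kernel_domain T = ({0..T} \<times> {0..T}) \<inter> {p. snd p \<le> fst p}"
    by (auto simp: kernel_domain_def)
  moreover have "closed {p :: real \<times> real. snd p \<le> fst p}"
    by (intro closed_Collect_le continuous_intros)
  ultimately show ?thesis
    by (simp add: compact_Int_closed compact_Times)
qed

lemma continuous_on_kernel_slice:
  assumes "continuous_on (kernel_domain T) (\<lambda>(t, s). G t s)" and "t \<in> {0..T}"
  shows "continuous_on {0..t} (G t)"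
proof -
  have "continuous_on {0..t} (\<lambda>s. (\<lambda>(t, s). G t s) (t, s))"
    by (rule continuous_on_compose2[OF assms(1)])
      (use assms(2) in \<open>auto intro!: continuous_intros kernel_domain_slice\<close>)
  then show ?thesis by simp
qed

text \<open>
  The substitution s = t \<sigma> turns the variable interval of integration into [0,1], where
  continuity in the parameter t is standard.
\<close>

lemma continuous_on_volterra_integral:
  fixes G :: "real \<Rightarrow> real \<Rightarrow> real"
  assumes G: "continuous_on (kernel_domain T) (\<lambda>(t, s). G t s)"
  shows "continuous_on {0..T} (\<lambda>t. integral {0..t} (G t))"
proof -
  have eq: "integral {0..t} (G t) = t * integral (cbox 0 1) (\<lambda>\<sigma>. G t (t * \<sigma>))"
    if t: "t \<in> {0..T}" for t
  proof (cases "t = 0")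
    case False
    have "G t integrable_on {0..t}"
      by (intro integrable_continuous_real continuous_on_kernel_slice[OF G t])
    then have "((\<lambda>\<sigma>. G t (t * \<sigma>)) has_integral (1 / \<bar>t\<bar>) *\<^sub>R integral {0..t} (G t))
        ((\<lambda>x. x / t) ` {0..t})"
      using False by (intro has_integral_stretch_real) (auto simp: has_integral_integral)
    moreover have "(\<lambda>x. x / t) ` {0..t} = {0..1}"
    proof -
      have "x \<in> (\<lambda>x. x / t) ` {0..t}" if "x \<in> {0..1}" for x
        using that t False by (intro image_eqI[of _ _ "x * t"]) (auto simp: mult_left_le_one_le)
      then show ?thesis using t False by (auto simp: field_simps)
    qed
    ultimately show ?thesis
      using t False by (simp add: integral_unique cbox_interval)
  qed simp
  have "continuous_on ({0..T} \<times> cbox 0 1) (\<lambda>p. (\<lambda>(t, s). G t s) (fst p, fst p * snd p))"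
    by (rule continuous_on_compose2[OF G])
      (auto intro!: continuous_intros simp: kernel_domain_def mult_left_le)
  then have "continuous_on ({0..T} \<times> cbox 0 1) (\<lambda>(t, \<sigma>). G t (t * \<sigma>))"
    by (simp add: case_prod_beta')
  from integral_continuous_on_param[OF this]
  have "continuous_on {0..T} (\<lambda>t. t * integral (cbox 0 1) (\<lambda>\<sigma>. G t (t * \<sigma>)))"
    by (intro continuous_intros)
  then show ?thesis
    using eq by (subst continuous_on_cong[OF refl]) auto
qed

text \<open>
  A homogeneous Gronwall inequality: \<open>exp (- c t)\<close> times the integral of d has nonpositive
  derivative, starts at 0 and is nonnegative, hence vanishes.
\<close>

lemma gronwall_zero:
  fixes d :: "real \<Rightarrow> real"
  assumes d: "continuous_on {0..T} d" and nonneg: "\<And>t. t \<in> {0..T} \<Longrightarrow> 0 \<le> d t"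
    and le: "\<And>t. t \<in> {0..T} \<Longrightarrow> d t \<le> c * integral {0..t} d"
    and t: "t \<in> {0..T}"
  shows "d t = 0"
proof -
  define I where "I = (\<lambda>t. integral {0..t} d)"
  have dI: "(I has_real_derivative d x) (at x within {0..T})" if "x \<in> {0..T}" for x
    unfolding I_def using integral_has_real_derivative[OF d that] .
  have cont: "continuous_on {0..T} (\<lambda>x. exp (- c * x) * I x)"
    by (intro continuous_intros DERIV_continuous_on[OF dI])
  have "exp (- c * t) * I t \<le> exp (- c * 0) * I 0"
  proof (rule DERIV_nonpos_imp_decreasing_open[where f = "\<lambda>x. exp (- c * x) * I x"])
    fix x assume x: "0 < x" "x < t"
    then have xT: "x \<in> {0..T}" "x \<in> interior {0..T}" using t by (auto simp: interior_atLeastAtMost_real)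
    then have "(I has_real_derivative d x) (at x)"
      using dI[of x] at_within_interior[of x "{0..T}"] by simp
    then have "((\<lambda>x. exp (- c * x) * I x) has_real_derivative exp (- c * x) * (d x - c * I x)) (at x)"
      by (auto intro!: derivative_eq_intros simp: algebra_simps)
    moreover have "exp (- c * x) * (d x - c * I x) \<le> 0"
      using le[OF xT(1)] by (simp add: I_def mult_le_0_iff)
    ultimately show "\<exists>y. ((\<lambda>x. exp (- c * x) * I x) has_real_derivative y) (at x) \<and> y \<le> 0"
      by blast
  next
    show "continuous_on {0..t} (\<lambda>x. exp (- c * x) * I x)"
      by (rule continuous_on_subset[OF cont]) (use t in auto)
  qed (use t in auto)
  then have "I t \<le> 0" by (simp add: I_def mult_le_0_iff)
  moreover have "0 \<le> I t"
    unfolding I_def using t nonneg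
    by (intro integral_nonneg integrable_continuous_real continuous_on_subset[OF d]) auto
  ultimately have "I t = 0" by simp
  then show ?thesis using le[OF t] nonneg[OF t] by (simp add: I_def)
qed

section \<open>The Volterra operator, its derivative and uniqueness of solutions\<close>

locale volterra_kernel =
  fixes T :: real and K Ku :: "real \<Rightarrow> real \<Rightarrow> real \<Rightarrow> real"
  assumes T_pos: "T > 0"
    and K_cont: "\<And>x. continuous_on (kernel_domain T) (\<lambda>(t, s). K t s x)"
    and K_lipschitz: "local_lipschitz (kernel_domain T) UNIV (\<lambda>(t, s). K t s)"
    and K_deriv: "\<And>t s x. (t, s) \<in> kernel_domain T \<Longrightarrow>
        ((\<lambda>y. K t s y) has_real_derivative Ku t s x) (at x)"
    and Ku_cont: "continuous_on (kernel_domain T \<times> UNIV) (\<lambda>((t, s), x). Ku t s x)"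
begin

text \<open>
  Separate continuity in (t,s) upgrades to joint continuity because the local Lipschitz bound in
  the last variable is uniform in (t,s).
\<close>

lemma K_joint_continuous: "continuous_on (kernel_domain T \<times> UNIV) (\<lambda>((t, s), x). K t s x)"
proof -
  have "continuous_on (kernel_domain T \<times> UNIV) (\<lambda>(p, x). (\<lambda>(t, s). K t s) p x)"
    by (rule Lipschitz.continuous_on_TimesI[OF K_lipschitz]) (use K_cont in \<open>simp add: case_prod_beta'\<close>)
  then show ?thesis by (simp add: case_prod_beta')
qed

lemma continuous_K_comp:
  "continuous_on (kernel_domain T) (\<lambda>(t, s). K t s (apply_bcontfun u s))"
proof -
  have "continuous_on (kernel_domain T) (\<lambda>p. (\<lambda>((t, s), x). K t s x) (p, apply_bcontfun u (snd p)))"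
    by (rule continuous_on_compose2[OF K_joint_continuous])
      (auto intro!: continuous_intros continuous_on_compose2[OF continuous_apply_bcontfun[of UNIV u]])
  then show ?thesis by (simp add: case_prod_beta')
qed

lemma continuous_Ku_comp:
  "continuous_on (kernel_domain T) (\<lambda>(t, s). Ku t s (apply_bcontfun u s) * apply_bcontfun v s)"
proof -
  have "continuous_on (kernel_domain T) (\<lambda>p. (\<lambda>((t, s), x). Ku t s x) (p, apply_bcontfun u (snd p)))"
    by (rule continuous_on_compose2[OF Ku_cont])
      (auto intro!: continuous_intros continuous_on_compose2[OF continuous_apply_bcontfun[of UNIV u]])
  then have "continuous_on (kernel_domain T) (\<lambda>p. (\<lambda>((t, s), x). Ku t s x) (p, apply_bcontfun u (snd p))
      * apply_bcontfun v (snd p))"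
    by (intro continuous_intros continuous_on_compose2[OF continuous_apply_bcontfun[of UNIV v]]) auto
  then show ?thesis by (simp add: case_prod_beta')
qed

lemma
  shows volterra_F_in_C: "volterra_F T K b u \<in> C_space T"
    and volterra_F_apply: "t \<in> {0..T} \<Longrightarrow> apply_bcontfun (volterra_F T K b u) t =
      apply_bcontfun u t - b - integral {0..t} (\<lambda>s. K t s (apply_bcontfun u s))"
proof -
  have "continuous_on {0..T}
      (\<lambda>t. apply_bcontfun u t - b - integral {0..t} (\<lambda>s. K t s (apply_bcontfun u s)))"
    by (intro continuous_intros continuous_apply_bcontfun
        continuous_on_volterra_integral continuous_K_comp)
  from apply_to_C[OF _ this] T_pos
  show "volterra_F T K b u \<in> C_space T"
    and "t \<in> {0..T} \<Longrightarrow> apply_bcontfun (volterra_F T K b u) t =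
      apply_bcontfun u t - b - integral {0..t} (\<lambda>s. K t s (apply_bcontfun u s))"
    by (simp_all add: volterra_F_def)
qed

lemma
  shows volterra_F'_in_C: "volterra_F' T Ku u v \<in> C_space T"
    and volterra_F'_apply: "t \<in> {0..T} \<Longrightarrow> apply_bcontfun (volterra_F' T Ku u v) t =
      apply_bcontfun v t - integral {0..t} (\<lambda>s. Ku t s (apply_bcontfun u s) * apply_bcontfun v s)"
proof -
  have "continuous_on {0..T} (\<lambda>t. apply_bcontfun v t
      - integral {0..t} (\<lambda>s. Ku t s (apply_bcontfun u s) * apply_bcontfun v s))"
    by (intro continuous_intros continuous_apply_bcontfun
        continuous_on_volterra_integral continuous_Ku_comp)
  from apply_to_C[OF _ this] T_pos
  show "volterra_F' T Ku u v \<in> C_space T"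
    and "t \<in> {0..T} \<Longrightarrow> apply_bcontfun (volterra_F' T Ku u v) t =
      apply_bcontfun v t - integral {0..t} (\<lambda>s. Ku t s (apply_bcontfun u s) * apply_bcontfun v s)"
    by (simp_all add: volterra_F'_def)
qed

lemma volterra_solution_iff:
  "volterra_solution T K b u \<longleftrightarrow> volterra_F T K b u = 0"
proof
  assume sol: "volterra_solution T K b u"
  show "volterra_F T K b u = 0"
    by (rule C_eqI[of T])
      (use sol T_pos in \<open>auto simp: volterra_F_in_C C_space_zero volterra_F_apply volterra_solution_def
        zero_bcontfun.rep_eq\<close>)
next
  assume F: "volterra_F T K b u = 0"
  show "volterra_solution T K b u"
    unfolding volterra_solution_def
  proof
    fix t assume "t \<in> {0..T}"
    from volterra_F_apply[OF this, of b u] F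
    show "apply_bcontfun u t = b + integral {0..t} (\<lambda>s. K t s (apply_bcontfun u s))"
      by (simp add: zero_bcontfun.rep_eq)
  qed
qed

text \<open>
  On bounded sets of values the partial derivative is bounded by compactness, so there K is
  uniformly Lipschitz in its last variable.
\<close>

lemma K_lipschitz_on_bounded:
  obtains c where "\<And>t s x y. (t, s) \<in> kernel_domain T \<Longrightarrow> \<bar>x\<bar> \<le> R \<Longrightarrow> \<bar>y\<bar> \<le> R \<Longrightarrow>
    \<bar>K t s x - K t s y\<bar> \<le> c * \<bar>x - y\<bar>"
proof -
  have "compact ((\<lambda>((t, s), x). Ku t s x) ` (kernel_domain T \<times> {- R..R}))"
    by (intro compact_continuous_image compact_Times compact_kernel_domain compact_Icc
        continuous_on_subset[OF Ku_cont]) auto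
  from compact_imp_bounded[OF this]
  obtain c where c: "\<And>t s x. (t, s) \<in> kernel_domain T \<Longrightarrow> x \<in> {- R..R} \<Longrightarrow> \<bar>Ku t s x\<bar> \<le> c"
    unfolding bounded_iff by fastforce
  have "norm (K t s x - K t s y) \<le> c * norm (x - y)"
    if "(t, s) \<in> kernel_domain T" "\<bar>x\<bar> \<le> R" "\<bar>y\<bar> \<le> R" for t s x y
  proof (rule field_differentiable_bound[of "{- R..R}"])
    show "(K t s has_field_derivative Ku t s z) (at z within {- R..R})" for z
      using K_deriv[OF that(1)] by (rule has_field_derivative_at_within)
  qed (use that c in auto)
  then show thesis by (intro that[of c]) simp
qed

lemma volterra_solution_unique:
  assumes "v \<in> C_space T" "w \<in> C_space T"
    and v: "volterra_solution T K b v" and w: "volterra_solution T K b w"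
  shows "v = w"
proof (rule C_eqI[of T])
  fix t assume t: "t \<in> {0..T}"
  define R where "R = max (norm v) (norm w)"
  obtain c where c: "\<And>t s x y. (t, s) \<in> kernel_domain T \<Longrightarrow> \<bar>x\<bar> \<le> R \<Longrightarrow> \<bar>y\<bar> \<le> R \<Longrightarrow>
      \<bar>K t s x - K t s y\<bar> \<le> c * \<bar>x - y\<bar>"
    using K_lipschitz_on_bounded[of R] by blast
  have R: "\<bar>apply_bcontfun v s\<bar> \<le> R" "\<bar>apply_bcontfun w s\<bar> \<le> R" for s
    using norm_bounded[of v s] norm_bounded[of w s] by (auto simp: R_def)
  define d where "d = (\<lambda>s. \<bar>apply_bcontfun v s - apply_bcontfun w s\<bar>)"
  have d: "continuous_on S d" for S
    unfolding d_def by (intro continuous_intros continuous_apply_bcontfun)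
  have "d t = 0"
  proof (rule gronwall_zero[of T d c])
    fix r assume r: "r \<in> {0..T}"
    have int: "(\<lambda>s. K r s (apply_bcontfun x s)) integrable_on {0..r}" for x
      by (intro integrable_continuous_real continuous_on_kernel_slice[OF continuous_K_comp r])
    have "apply_bcontfun v r - apply_bcontfun w r =
        integral {0..r} (\<lambda>s. K r s (apply_bcontfun v s) - K r s (apply_bcontfun w s))"
      using v w r unfolding volterra_solution_def by (simp add: integral_diff int)
    also have "norm \<dots> \<le> integral {0..r} (\<lambda>s. c * d s)"
    proof (rule integral_norm_bound_integral)
      show "(\<lambda>s. c * d s) integrable_on {0..r}"
        by (intro integrable_continuous_real continuous_intros d)
      show "norm (K r s (apply_bcontfun v s) - K r s (apply_bcontfun w s)) \<le> c * d s"
        if "s \<in> {0..r}" for s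
        unfolding d_def using c[OF kernel_domain_slice[OF r that] R] by simp
    qed (intro integrable_diff int)
    finally show "d r \<le> c * integral {0..r} d" by (simp add: d_def)
  qed (use d t in \<open>auto simp: d_def\<close>)
  then show "apply_bcontfun v t = apply_bcontfun w t" by (simp add: d_def)
qed (use assms T_pos in auto)

text \<open>
  Differentiation under the integral sign at a fixed time t; the integrand is jointly continuous
  in the segment parameter and s, and the interval of integration does not move.
\<close>

lemma volterra_F_has_derivative_on_segment:
  assumes t: "t \<in> {0..T}"
  shows "((\<lambda>\<theta>. apply_bcontfun (volterra_F T K b (w + \<theta> *\<^sub>R h)) t) has_real_derivative
    apply_bcontfun (volterra_F' T Ku (w + \<theta> *\<^sub>R h) h) t) (at \<theta>)"
proof -
  let ?u = "\<lambda>\<theta> s. apply_bcontfun w s + \<theta> * apply_bcontfun h s"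
  have int: "((\<lambda>\<theta>. integral (cbox 0 t) (\<lambda>s. K t s (?u \<theta> s))) has_real_derivative
      integral (cbox 0 t) (\<lambda>s. Ku t s (?u \<theta> s) * apply_bcontfun h s)) (at \<theta>)"
  proof (rule leibniz_rule_field_derivative[where U = UNIV])
    fix \<theta> s :: real assume "s \<in> cbox 0 t"
    then have ts: "(t, s) \<in> kernel_domain T" using t by (auto intro: kernel_domain_slice)
    show "((\<lambda>\<theta>. K t s (?u \<theta> s)) has_real_derivative Ku t s (?u \<theta> s) * apply_bcontfun h s) (at \<theta>)"
      by (rule DERIV_chain2[OF K_deriv[OF ts]]) (auto intro!: derivative_eq_intros)
  next
    fix \<theta> :: real
    show "(\<lambda>s. K t s (?u \<theta> s)) integrable_on cbox 0 t"
      using integrable_continuous_real[OF continuous_on_kernel_slice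
          [OF continuous_K_comp[of "w + \<theta> *\<^sub>R h"] t]]
      by (simp add: plus_bcontfun.rep_eq scaleR_bcontfun.rep_eq)
  next
    have "continuous_on (UNIV \<times> cbox 0 t)
        (\<lambda>q. (\<lambda>((t, s), x). Ku t s x) ((t, snd q), ?u (fst q) (snd q)))"
      by (rule continuous_on_compose2[OF Ku_cont])
        (use t in \<open>auto intro!: continuous_intros kernel_domain_slice
          continuous_on_compose2[OF continuous_apply_bcontfun[of UNIV]]\<close>)
    then have "continuous_on (UNIV \<times> cbox 0 t)
        (\<lambda>q. (\<lambda>((t, s), x). Ku t s x) ((t, snd q), ?u (fst q) (snd q)) * apply_bcontfun h (snd q))"
      by (intro continuous_intros continuous_on_compose2[OF continuous_apply_bcontfun[of UNIV h]]) auto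
    then show "continuous_on (UNIV \<times> cbox 0 t)
        (\<lambda>(\<theta>, s). Ku t s (?u \<theta> s) * apply_bcontfun h s)"
      by (simp add: case_prod_beta')
  qed auto
  show ?thesis
    unfolding volterra_F_apply[OF t] volterra_F'_apply[OF t] plus_bcontfun.rep_eq scaleR_bcontfun.rep_eq
    using int by (auto intro!: derivative_eq_intros simp: cbox_interval)
qed

text \<open>
  The remainder at time t is the increment over [0,1] of g, the value of F along the segment minus
  its linearisation at w.  The derivative of g is at most c \<theta> in absolute value, so comparison
  with the primitive c \<theta>^2 / 2 produces the factor 1/2.
\<close>

lemma volterra_F_taylor_remainder:
  assumes lip: "\<And>\<theta>. 0 \<le> \<theta> \<Longrightarrow> \<theta> \<le> 1 \<Longrightarrow>
      norm (volterra_F' T Ku (w + \<theta> *\<^sub>R h) h - volterra_F' T Ku w h) \<le> c * \<theta>"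
  shows "norm (volterra_F T K b (w + h) - volterra_F T K b w - volterra_F' T Ku w h) \<le> c / 2"
proof (rule norm_C_le[of T])
  fix t assume t: "t \<in> {0..T}"
  let ?A = "apply_bcontfun (volterra_F' T Ku w h) t"
  define g where "g = (\<lambda>\<theta>. apply_bcontfun (volterra_F T K b (w + \<theta> *\<^sub>R h)) t - \<theta> * ?A)"
  have g: "(g has_real_derivative apply_bcontfun (volterra_F' T Ku (w + \<theta> *\<^sub>R h) h) t - ?A) (at \<theta>)"
    for \<theta>
    unfolding g_def
    by (auto intro!: derivative_eq_intros volterra_F_has_derivative_on_segment[OF t])
  have "norm (g 1 - g 0) \<le> c / 2 * 1\<^sup>2 - c / 2 * 0\<^sup>2"
  proof (rule differentiable_bound_general)
    show "continuous_on {0..1} g"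
      using g by (intro DERIV_continuous_on) (auto intro: has_field_derivative_at_within)
    show "(g has_vector_derivative apply_bcontfun (volterra_F' T Ku (w + x *\<^sub>R h) h) t - ?A) (at x)" for x
      using g by (simp add: has_real_derivative_iff_has_vector_derivative)
    show "((\<lambda>x. c / 2 * x\<^sup>2) has_vector_derivative c * x) (at x)" for x
      unfolding has_real_derivative_iff_has_vector_derivative[symmetric]
      by (auto intro!: derivative_eq_intros)
    show "norm (apply_bcontfun (volterra_F' T Ku (w + x *\<^sub>R h) h) t - ?A) \<le> c * x"
      if "0 < x" "x < 1" for x
      using norm_bounded[of "volterra_F' T Ku (w + x *\<^sub>R h) h - volterra_F' T Ku w h" t] lip[of x] that
      by (simp add: minus_bcontfun.rep_eq)
  qed (auto intro!: continuous_intros)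
  then show "\<bar>apply_bcontfun (volterra_F T K b (w + h) - volterra_F T K b w - volterra_F' T Ku w h) t\<bar>
      \<le> c / 2"
    by (simp add: g_def minus_bcontfun.rep_eq algebra_simps)
qed (use T_pos in \<open>auto intro!: C_space_diff volterra_F_in_C volterra_F'_in_C\<close>)

section \<open>Convergence of the Newton-Kantorovich iteration\<close>

text \<open>
  Let A be the derivative at w.  The new error is the inverse of A applied to
  A (w - z) - F(w), and since F(z) = 0 this argument is the Taylor remainder of F at w evaluated in z.
\<close>

lemma newton_step_error:
  assumes z: "z \<in> C_space T" "volterra_F T K b z = 0" and w: "w \<in> C_space T"
    and inv: "invertible_C T (volterra_F' T Ku w)"
    and M: "opnorm_C T (inverse_C T (volterra_F' T Ku w)) \<le> M"
    and lip: "\<And>\<theta>. 0 \<le> \<theta> \<Longrightarrow> \<theta> \<le> 1 \<Longrightarrow>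
      norm (volterra_F' T Ku (w + \<theta> *\<^sub>R (z - w)) (z - w) - volterra_F' T Ku w (z - w))
        \<le> c * \<theta>"
  shows "norm (w - inverse_C T (volterra_F' T Ku w) (volterra_F T K b w) - z) \<le> M * (c / 2)"
proof -
  let ?A = "volterra_F' T Ku w" and ?B = "inverse_C T (volterra_F' T Ku w)"
  have lin: "bounded_linear_C T ?A" "bounded_linear_C T ?B"
    using inv by (auto simp: invertible_C_def)
  have e: "w - z \<in> C_space T" using w z by (simp add: C_space_diff)
  have rem_in: "?A (w - z) - volterra_F T K b w \<in> C_space T"
    by (intro C_space_diff volterra_F_in_C volterra_F'_in_C)
  have "w - ?B (volterra_F T K b w) - z = ?B (?A (w - z)) - ?B (volterra_F T K b w)"
    using inverse_C_left[OF inv e] by simp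
  also have "\<dots> = ?B (?A (w - z) - volterra_F T K b w)"
    by (rule bounded_linear_C_diff[OF lin(2), symmetric]) (intro volterra_F_in_C volterra_F'_in_C)+
  also have "norm \<dots> \<le> opnorm_C T ?B * norm (?A (w - z) - volterra_F T K b w)"
    by (rule opnorm_C_bound[OF lin(2) rem_in])
  also have "\<dots> \<le> M * norm (?A (w - z) - volterra_F T K b w)"
    by (intro mult_right_mono M) simp
  also have "\<dots> \<le> M * (c / 2)"
  proof (rule mult_left_mono)
    have "?A (w - z) - volterra_F T K b w
        = volterra_F T K b (w + (z - w)) - volterra_F T K b w - ?A (z - w)"
      using z(2) bounded_linear_C_diff[OF lin(1) w z(1)] bounded_linear_C_diff[OF lin(1) z(1) w]
      by simp
    then show "norm (?A (w - z) - volterra_F T K b w) \<le> c / 2"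
      using volterra_F_taylor_remainder[OF lip, of b] by (simp only:)
    show "0 \<le> M" using opnorm_C_nonneg[OF lin(2)] M by linarith
  qed
  finally show ?thesis .
qed

end

theorem theorem3p1:
  fixes T b L M :: real
    and K Ku :: "real \<Rightarrow> real \<Rightarrow> real \<Rightarrow> real"
    and ustar u0 :: "real \<Rightarrow>\<^sub>C real"
    and N :: "(real \<Rightarrow>\<^sub>C real) set"
    and u :: "nat \<Rightarrow> (real \<Rightarrow>\<^sub>C real)"
  assumes T_pos: "T > 0"
    and K_cont: "\<And>x. continuous_on (kernel_domain T) (\<lambda>(t, s). K t s x)"
    and K_lipschitz: "local_lipschitz (kernel_domain T) UNIV (\<lambda>(t, s). K t s)"
    and K_deriv: "\<And>t s x. (t, s) \<in> kernel_domain T \<Longrightarrow>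
        ((\<lambda>y. K t s y) has_real_derivative Ku t s x) (at x)"
    and Ku_cont: "continuous_on (kernel_domain T \<times> UNIV) (\<lambda>((t, s), x). Ku t s x)"
    and ustar: "ustar \<in> C_space T" "volterra_F T K b ustar = 0"
    and N_nbhd: "N \<subseteq> C_space T" "\<exists>r>0. ball ustar r \<inter> C_space T \<subseteq> N"
    and N_invertible: "\<And>w. w \<in> N \<Longrightarrow> invertible_C T (volterra_F' T Ku w)"
    and N_lipschitz: "\<And>w1 w2. w1 \<in> N \<Longrightarrow> w2 \<in> N \<Longrightarrow>
        opnorm_C T (\<lambda>v. volterra_F' T Ku w1 v - volterra_F' T Ku w2 v) \<le> L * norm (w1 - w2)"
    and u0: "u0 \<in> C_space T" "cball ustar (norm (u0 - ustar)) \<inter> C_space T \<subseteq> N"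
    and u_def: "u = newton T K Ku b u0"
    and M_finite: "bdd_above (range (\<lambda>n. opnorm_C T (inverse_C T (volterra_F' T Ku (u n)))))"
    and M_def: "M = (SUP n. opnorm_C T (inverse_C T (volterra_F' T Ku (u n))))"
    and small: "L * M * norm (u0 - ustar) < 1"
  shows "(\<forall>n. u n \<in> C_space T \<and> invertible_C T (volterra_F' T Ku (u n))) \<and>
    {v \<in> C_space T. volterra_solution T K b v} = {ustar} \<and>
    u \<longlonglongrightarrow> ustar \<and>
    (\<forall>n. norm (u (Suc n) - ustar) \<le> (1 / 2 * L * M) * (norm (u n - ustar))\<^sup>2)"
proof -
  interpret volterra_kernel T K Ku
    using T_pos K_cont K_lipschitz K_deriv Ku_cont by unfold_locales
  let ?A = "\<lambda>w. volterra_F' T Ku w"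
  have blin: "bounded_linear_C T (\<lambda>v. ?A w1 v - ?A w2 v)" if "w1 \<in> N" "w2 \<in> N" for w1 w2
    using N_invertible that by (intro bounded_linear_C_minus_fun) (auto simp: invertible_C_def)
  have ustar_N: "ustar \<in> N" using u0(2) ustar(1) by auto

  \<comment> \<open>L is nonnegative because N contains two points at positive distance, one of them a
    translate of the solution by a small constant, and operator norms are nonnegative.\<close>
  have L: "0 \<le> L"
  proof -
    obtain r where r: "r > 0" "ball ustar r \<inter> C_space T \<subseteq> N" using N_nbhd(2) by blast
    define k where "k = (const_bcontfun (r / 2) :: real \<Rightarrow>\<^sub>C real)"
    have "r / 2 \<le> norm k"
      using norm_bounded[of k 0] r(1) by (simp add: k_def const_bcontfun.rep_eq)
    moreover have "norm k \<le> r / 2"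
      using r(1) by (intro norm_bound) (simp add: k_def const_bcontfun.rep_eq)
    ultimately have k: "norm k = r / 2" by simp
    then have kN: "ustar + k \<in> N"
      using r ustar(1) by (auto simp: dist_norm k_def intro!: C_space_add C_space_const)
    have "0 \<le> L * norm (ustar + k - ustar)"
      by (rule order_trans[OF opnorm_C_nonneg[OF blin[OF kN ustar_N]] N_lipschitz[OF kN ustar_N]])
    then show ?thesis using k r(1) by (simp add: zero_le_mult_iff)
  qed

  have M_upper: "opnorm_C T (inverse_C T (?A (u n))) \<le> M" for n
    unfolding M_def by (intro cSUP_upper M_finite) auto
  have in_N: "w \<in> N" if "w \<in> C_space T" "norm (w - ustar) \<le> norm (u0 - ustar)" for w
    using u0(2) that by (auto simp: dist_norm norm_minus_commute)
  then have u0_N: "u0 \<in> N" using u0(1) by simp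
  have M: "0 \<le> M"
  proof -
    have "bounded_linear_C T (inverse_C T (?A (u 0)))"
      using N_invertible[OF u0_N] by (simp add: u_def invertible_C_def)
    from order_trans[OF opnorm_C_nonneg[OF this] M_upper] show ?thesis .
  qed

  \<comment> \<open>The segment from the iterate to the solution stays in the ball, hence in N, so the Lipschitz
    condition applies along it.\<close>
  have step: "norm (u (Suc n) - ustar) \<le> (1 / 2 * L * M) * (norm (u n - ustar))\<^sup>2"
    if un: "u n \<in> C_space T" "norm (u n - ustar) \<le> norm (u0 - ustar)" for n
  proof -
    let ?h = "ustar - u n"
    have "norm (?A (u n + \<theta> *\<^sub>R ?h) ?h - ?A (u n) ?h) \<le> L * (norm ?h)\<^sup>2 * \<theta>"
      if \<theta>: "0 \<le> \<theta>" "\<theta> \<le> 1" for \<theta>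
    proof -
      have C: "u n + \<theta> *\<^sub>R ?h \<in> C_space T" "?h \<in> C_space T"
        using un ustar(1) by (auto intro!: C_space_add C_space_scaleR C_space_diff)
      have "u n + \<theta> *\<^sub>R ?h - ustar = (1 - \<theta>) *\<^sub>R (u n - ustar)"
        by (simp add: algebra_simps)
      then have "norm (u n + \<theta> *\<^sub>R ?h - ustar) \<le> norm (u n - ustar)"
        using \<theta> by (simp add: mult_left_le_one_le)
      then have N: "u n + \<theta> *\<^sub>R ?h \<in> N" "u n \<in> N"
        using in_N C(1) un by auto
      have "norm (?A (u n + \<theta> *\<^sub>R ?h) ?h - ?A (u n) ?h)
          \<le> opnorm_C T (\<lambda>v. ?A (u n + \<theta> *\<^sub>R ?h) v - ?A (u n) v) * norm ?h"
        by (rule opnorm_C_bound[OF blin[OF N] C(2)])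
      also have "\<dots> \<le> L * norm (u n + \<theta> *\<^sub>R ?h - u n) * norm ?h"
        by (intro mult_right_mono N_lipschitz N) simp
      also have "norm (u n + \<theta> *\<^sub>R ?h - u n) = \<theta> * norm ?h"
        using \<theta> by simp
      finally show ?thesis by (simp add: power2_eq_square mult_ac)
    qed
    from newton_step_error[OF ustar un(1) N_invertible[OF in_N[OF un]] M_upper this]
    show ?thesis
      by (simp add: u_def norm_minus_commute algebra_simps)
  qed

  \<comment> \<open>Inside the ball one quadratic factor is at most the initial error, so the error also
    contracts by the fixed ratio q. This keeps every iterate in the ball.\<close>
  define q where "q = L * M * norm (u0 - ustar) / 2"
  have q: "0 \<le> q" "q < 1" using L M small by (auto simp: q_def)
  have inv: "u n \<in> C_space T \<and> norm (u n - ustar) \<le> q ^ n * norm (u0 - ustar)" for n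
  proof (induction n)
    case 0
    then show ?case using u0(1) by (simp add: u_def)
  next
    case (Suc n)
    have "q ^ n * norm (u0 - ustar) \<le> norm (u0 - ustar)"
      using q by (intro mult_left_le_one_le) (auto simp: power_le_one)
    then have un: "u n \<in> C_space T" "norm (u n - ustar) \<le> norm (u0 - ustar)"
      using Suc by auto
    have "u (Suc n) \<in> C_space T"
      using un N_invertible[OF in_N[OF un]]
      by (auto simp: u_def intro!: C_space_diff inverse_C_closed volterra_F_in_C)
    moreover have "norm (u (Suc n) - ustar) \<le> q * norm (u n - ustar)"
    proof -
      have "norm (u (Suc n) - ustar) \<le> (1 / 2 * L * M * norm (u n - ustar)) * norm (u n - ustar)"
        using step[OF un] by (simp add: power2_eq_square algebra_simps)
      also have "\<dots> \<le> (1 / 2 * L * M * norm (u0 - ustar)) * norm (u n - ustar)"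
        using un(2) L M by (intro mult_right_mono mult_left_mono) auto
      finally show ?thesis by (simp add: q_def)
    qed
    moreover have "q * norm (u n - ustar) \<le> q * (q ^ n * norm (u0 - ustar))"
      using q Suc by (intro mult_left_mono) auto
    ultimately show ?case by (simp add: mult.assoc)
  qed
  have un: "u n \<in> C_space T" "norm (u n - ustar) \<le> norm (u0 - ustar)" for n
  proof -
    have "q ^ n * norm (u0 - ustar) \<le> norm (u0 - ustar)"
      using q by (intro mult_left_le_one_le) (auto simp: power_le_one)
    then show "u n \<in> C_space T" "norm (u n - ustar) \<le> norm (u0 - ustar)"
      using inv[of n] by auto
  qed
  have "(\<lambda>n. q ^ n * norm (u0 - ustar)) \<longlonglongrightarrow> 0"
    using q by (intro tendsto_mult_left_zero LIMSEQ_power_zero) simp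
  then have "(\<lambda>n. u n - ustar) \<longlonglongrightarrow> 0"
    by (rule Lim_null_comparison[rotated]) (use inv in auto)
  then have "u \<longlonglongrightarrow> ustar" by (simp add: LIM_zero_iff)
  moreover have "{v \<in> C_space T. volterra_solution T K b v} = {ustar}"
    using ustar volterra_solution_iff[of b ustar] volterra_solution_unique[of _ ustar b] by blast
  ultimately show ?thesis
    using un step N_invertible in_N by blast
qed

end
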